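(* Let $X$ be a real Banach space and $\{T_n:X\rightrightarrows X^*\}_{n\in\mathbb{N}}$ a sequence of maximal monotone operators of type (D). Then the lower limit $T=\liminf T_n$ is representable.
   Context: Operators are identified with their graphs; $\langle\cdot,\cdot\rangle$ is the duality pairing and $X\subset X^{**}$ canonically. Monotone: $\langle x-y,x^*-y^*\rangle\ge0$ on the graph; maximal monotone: not properly contained in a monotone operator. For maximal monotone $T$, $\widetilde T=\{(x^{**},x^* )\in X^{**}\times X^*: \langle x^{**}-y,x^*-y^*\rangle\ge 0\ \forall (y,y^* )\in T\}$; $T$ is of type (D) if each point of $\widetilde T$ is the weak$^*\times$norm limit of a bounded net in $T$. $\liminf T_n=\{(x,x^* ): \exists (y_n,y_n^* )\in T_n,\ (y_n,y_n^* )\to(x,x^* )\text{ in norm}\times\text{norm}\}$. An operator $T\subset X\times X^*$ is representable if there exists a convex, proper, (norm) lower semicontinuous $h:X\times X^*\to\mathbb{R}\cup\{+\infty\}$ with $h(x,x^* )\ge\langle x,x^*\rangle$ for all $(x,x^* )$ and $T=\{(x,x^* ): h(x,x^* )=\langle x,x^*\rangle\}$. *)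

theory Defs
  imports "HOL-Analysis.Analysis"
begin

text \<open>X is a real Banach space ('a::banach); its dual X* is the type 'a \<Rightarrow>L real,
  the bidual X** is ('a \<Rightarrow>L real) \<Rightarrow>L real.  The duality pairing is function application.
  Operators X \<rightrightarrows> X* are identified with their graphs, i.e. sets of pairs.\<close>

definition monotone_op :: "('a::real_normed_vector \<times> ('a \<Rightarrow>\<^sub>L real)) set \<Rightarrow> bool" where
  "monotone_op T \<longleftrightarrow>
     (\<forall>(x, xs) \<in> T. \<forall>(y, ys) \<in> T. blinfun_apply (xs - ys) (x - y) \<ge> 0)"

definition maximal_monotone :: "('a::real_normed_vector \<times> ('a \<Rightarrow>\<^sub>L real)) set \<Rightarrow> bool" where
  "maximal_monotone T \<longleftrightarrow> monotone_op T \<and> (\<forall>S. monotone_op S \<and> T \<subseteq> S \<longrightarrow> S = T)"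

text \<open>The extension tilde T in X** \<times> X*; the pairing of x** - y with x* - y* is
  x**(x* - y*) - (x* - y*)(y), using the canonical embedding of X into X**.\<close>
definition tilde_op ::
  "('a::real_normed_vector \<times> ('a \<Rightarrow>\<^sub>L real)) set \<Rightarrow> ((('a \<Rightarrow>\<^sub>L real) \<Rightarrow>\<^sub>L real) \<times> ('a \<Rightarrow>\<^sub>L real)) set" where
  "tilde_op T = {(xss, xs). \<forall>(y, ys) \<in> T.
       blinfun_apply xss (xs - ys) - blinfun_apply (xs - ys) y \<ge> 0}"

text \<open>Type (D): every point of tilde T is the weak*\<times>norm limit of a bounded net in T.
  Nets are expressed by (proper) filters on X \<times> X*: a net (y_i, y_i*) corresponds to its
  image filter; the net lies in T and is bounded (by M); y_i \<rightarrow> x** weak* in X** means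
  f(y_i) \<rightarrow> x**(f) for every f in X*; and y_i* \<rightarrow> x* in norm.\<close>
definition type_D :: "('a::real_normed_vector \<times> ('a \<Rightarrow>\<^sub>L real)) set \<Rightarrow> bool" where
  "type_D T \<longleftrightarrow> maximal_monotone T \<and>
     (\<forall>(xss, xs) \<in> tilde_op T. \<exists>(F :: ('a \<times> ('a \<Rightarrow>\<^sub>L real)) filter) M.
        F \<noteq> bot \<and>
        (\<forall>\<^sub>F p in F. p \<in> T \<and> norm (fst p) \<le> M \<and> norm (snd p) \<le> M) \<and>
        (\<forall>f. ((\<lambda>p. blinfun_apply f (fst p)) \<longlongrightarrow> blinfun_apply xss f) F) \<and>
        ((\<lambda>p. snd p) \<longlongrightarrow> xs) F)"

definition liminf_op ::
  "(nat \<Rightarrow> ('a::real_normed_vector \<times> ('a \<Rightarrow>\<^sub>L real)) set) \<Rightarrow> ('a \<times> ('a \<Rightarrow>\<^sub>L real)) set" where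
  "liminf_op Ts = {(x, xs). \<exists>y ys. (\<forall>n. (y n, ys n) \<in> Ts n) \<and>
       y \<longlonglongrightarrow> x \<and> ys \<longlonglongrightarrow> xs}"

text \<open>Functions with values in R \<union> {+\<infinity>} are modelled as ereal-valued functions
  that never take the value -\<infinity>.\<close>
definition ereal_convex :: "('b::real_vector \<Rightarrow> ereal) \<Rightarrow> bool" where
  "ereal_convex h \<longleftrightarrow> (\<forall>p q. \<forall>t::real. 0 < t \<and> t < 1 \<longrightarrow>
      h (t *\<^sub>R p + (1 - t) *\<^sub>R q) \<le> ereal t * h p + ereal (1 - t) * h q)"

definition ereal_proper :: "('b \<Rightarrow> ereal) \<Rightarrow> bool" where
  "ereal_proper h \<longleftrightarrow> (\<forall>p. h p \<noteq> -\<infinity>) \<and> (\<exists>p. h p \<noteq> \<infinity>)"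

definition ereal_lsc :: "('b::topological_space \<Rightarrow> ereal) \<Rightarrow> bool" where
  "ereal_lsc h \<longleftrightarrow> (\<forall>p c. c < h p \<longrightarrow> (\<forall>\<^sub>F q in at p. c < h q))"

definition representable :: "('a::real_normed_vector \<times> ('a \<Rightarrow>\<^sub>L real)) set \<Rightarrow> bool" where
  "representable T \<longleftrightarrow> (\<exists>h :: 'a \<times> ('a \<Rightarrow>\<^sub>L real) \<Rightarrow> ereal.
      ereal_convex h \<and> ereal_proper h \<and> ereal_lsc h \<and>
      (\<forall>x xs. h (x, xs) \<ge> ereal (blinfun_apply xs x)) \<and>
      T = {(x, xs). h (x, xs) = ereal (blinfun_apply xs x)})"

end

theory Submission
  imports Defs
begin

text \<open>The representing function is the epigraphical upper limit of the Fitzpatrick functions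
  \<open>\<phi>\<^sub>n\<close> of the \<open>T\<^sub>n\<close>: its epigraph is the lower limit of the epigraphs of the \<open>\<phi>\<^sub>n\<close>, hence closed and
  convex. It dominates the duality product because every \<open>\<phi>\<^sub>n\<close> does. Where it equals the duality
  product there are points \<open>q\<^sub>n \<rightarrow> p\<close> with \<open>\<phi>\<^sub>n(q\<^sub>n) - \<langle>q\<^sub>n\<rangle> \<rightarrow> 0\<close>, and a Bronsted--Rockafellar property
  whose constants do not depend on \<open>n\<close> moves \<open>q\<^sub>n\<close> to a nearby point of \<open>T\<^sub>n\<close>.

  For that property, let \<open>g\<close> be the convex hull of the duality product restricted to \<open>T - q\<close>. Type (D)
  gives \<open>g\<^sup>*(x\<^sup>*, x\<^sup>*\<^sup>*) \<ge> \<langle>x\<^sup>*, x\<^sup>*\<^sup>*\<rangle>\<close>, so by Fenchel duality the infimum of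
  \<open>g + \<parallel>\<cdot>\<parallel>\<^sup>2/2\<close> is at most 0. An almost minimiser is close to the origin and almost solves the inclusion;
  iterating with geometrically decreasing errors converges to a point of \<open>T\<close> by maximality.\<close>

section \<open>Hahn--Banach and Fenchel duality\<close>

definition sublinear :: "('b::real_vector \<Rightarrow> real) \<Rightarrow> bool" where
  "sublinear p \<longleftrightarrow> (\<forall>x y. p (x + y) \<le> p x + p y) \<and> (\<forall>s x. s > 0 \<longrightarrow> p (s *\<^sub>R x) = s * p x)"

lemma sublinear_zero: "sublinear p \<Longrightarrow> p 0 = 0"
proof -
  assume "sublinear p"
  then have "p (2 *\<^sub>R 0) = 2 * p 0" unfolding sublinear_def by (metis zero_less_numeral)
  then show ?thesis by simp
qed

lemma sublinear_minus: "sublinear p \<Longrightarrow> - p (- x) \<le> p x"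
proof -
  assume s: "sublinear p"
  then have "p (x + - x) \<le> p x + p (- x)" unfolding sublinear_def by blast
  then show ?thesis using sublinear_zero[OF s] by simp
qed

text \<open>The members \<open>g i\<close> need not be sublinear: it suffices that sums and positive
  multiples of their values dominate the value of some further member. This serves three infima:
  along a ray, over a chain, and in Fenchel duality.\<close>

lemma sublinear_INF:
  fixes g :: "'i \<Rightarrow> 'b::real_vector \<Rightarrow> real"
  assumes ne: "I \<noteq> {}"
    and bdd: "\<And>x. bdd_below ((\<lambda>i. g i x) ` I)"
    and add: "\<And>i j x y. i \<in> I \<Longrightarrow> j \<in> I \<Longrightarrow> \<exists>k\<in>I. g k (x + y) \<le> g i x + g j y"
    and scale: "\<And>i s x. i \<in> I \<Longrightarrow> s > 0 \<Longrightarrow> \<exists>k\<in>I. g k (s *\<^sub>R x) \<le> s * g i x"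
  shows "sublinear (\<lambda>x. INF i\<in>I. g i x)"
proof -
  let ?p = "\<lambda>x. INF i\<in>I. g i x"
  have low: "?p x \<le> g i x" if "i \<in> I" for i x
    using cINF_lower[OF bdd that] .
  have sc: "?p (s *\<^sub>R x) \<le> s * ?p x" if s: "s > 0" for s x
  proof -
    have "?p (s *\<^sub>R x) / s \<le> ?p x"
    proof (rule cINF_greatest[OF ne])
      fix i assume "i \<in> I"
      then obtain k where "k \<in> I" "g k (s *\<^sub>R x) \<le> s * g i x" using scale s by blast
      then have "?p (s *\<^sub>R x) \<le> s * g i x" using low by (meson order_trans)
      then show "?p (s *\<^sub>R x) / s \<le> g i x" using s by (simp add: field_simps)
    qed
    then show ?thesis using s by (simp add: field_simps)
  qed
  show ?thesis unfolding sublinear_def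
  proof (intro conjI allI impI)
    fix x y
    have "?p (x + y) - ?p y \<le> g i x" if i: "i \<in> I" for i
    proof -
      have "?p (x + y) - g i x \<le> ?p y"
      proof (rule cINF_greatest[OF ne])
        fix j assume "j \<in> I"
        then obtain k where "k \<in> I" "g k (x + y) \<le> g i x + g j y" using add i by blast
        then show "?p (x + y) - g i x \<le> g j y" using low[of k "x + y"] by linarith
      qed
      then show ?thesis by linarith
    qed
    then have "?p (x + y) - ?p y \<le> ?p x" by (intro cINF_greatest[OF ne])
    then show "?p (x + y) \<le> ?p x + ?p y" by linarith
  next
    fix s :: real and x assume s: "s > 0"
    have "?p (inverse s *\<^sub>R (s *\<^sub>R x)) \<le> inverse s * ?p (s *\<^sub>R x)"
      using s by (intro sc) simp
    then have "s * ?p x \<le> ?p (s *\<^sub>R x)" using s by (simp add: field_simps)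
    then show "?p (s *\<^sub>R x) = s * ?p x" using sc[OF s, of x] by linarith
  qed
qed

text \<open>For fixed \<open>y\<close>, the infimum over \<open>t \<ge> 0\<close> of
  \<open>q (x + t *\<^sub>R y) - t * q y\<close> is sublinear and, by \<open>t = 0\<close>, below
  \<open>q\<close>, so minimality makes it equal to \<open>q\<close>. Then \<open>t = 1\<close>
  gives superadditivity.\<close>

lemma minimal_sublinear_linear:
  fixes q :: "'b::real_vector \<Rightarrow> real"
  assumes q: "sublinear q"
    and min: "\<And>r. sublinear r \<Longrightarrow> (\<And>x. r x \<le> q x) \<Longrightarrow> r = q"
  shows "linear q"
proof -
  have qadd: "q (x + y) \<le> q x + q y" and qsc: "s > 0 \<Longrightarrow> q (s *\<^sub>R x) = s * q x" for x y s
    using q unfolding sublinear_def by blast+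
  have qsc0: "q (s *\<^sub>R x) = s * q x" if "s \<ge> 0" for s x
    using that qsc[of s x] sublinear_zero[OF q] by (cases "s = 0") auto
  have super: "q x + q y \<le> q (x + y)" for x y
  proof -
    let ?g = "\<lambda>t x. q (x + t *\<^sub>R y) - t * q y"
    let ?r = "\<lambda>x. INF t\<in>{0::real..}. ?g t x"
    have lower: "- q (- x) \<le> ?g t x" if "t \<ge> 0" for t x
    proof -
      have "q (t *\<^sub>R y) \<le> q (x + t *\<^sub>R y) + q (- x)"
        using qadd[of "x + t *\<^sub>R y" "- x"] by simp
      then show ?thesis using qsc0[OF that, of y] by linarith
    qed
    have bdd: "bdd_below ((\<lambda>t. ?g t x) ` {0..})" for x
      using lower by (intro bdd_belowI[of _ "- q (- x)"]) auto
    have "sublinear ?r"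
    proof (rule sublinear_INF)
      fix i j :: real and x z assume "i \<in> {0..}" "j \<in> {0..}"
      then show "\<exists>k\<in>{0..}. ?g k (x + z) \<le> ?g i x + ?g j z"
        using qadd[of "x + i *\<^sub>R y" "z + j *\<^sub>R y"]
        by (intro bexI[of _ "i + j"]) (auto simp: algebra_simps)
    next
      fix i s :: real and x assume "i \<in> {0..}" "0 < s"
      then show "\<exists>k\<in>{0..}. ?g k (s *\<^sub>R x) \<le> s * ?g i x"
        using qsc[of s "x + i *\<^sub>R y"]
        by (intro bexI[of _ "s * i"]) (auto simp: algebra_simps)
    qed (use bdd in auto)
    moreover have "?r z \<le> q z" for z
      using cINF_lower[OF bdd, of 0 z] by simp
    ultimately have "?r = q" by (rule min)
    moreover have "?r x \<le> ?g 1 x" by (rule cINF_lower[OF bdd]) simp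
    ultimately have "q x \<le> ?g 1 x" by (simp only: fun_eq_iff)
    then show ?thesis by simp
  qed
  have qplus: "q (x + y) = q x + q y" for x y
    using super qadd by (meson antisym)
  have qneg: "q (- x) = - q x" for x
    using qplus[of x "- x"] sublinear_zero[OF q] by simp
  show ?thesis
  proof (rule linearI)
    fix s :: real and x
    show "q (s *\<^sub>R x) = s *\<^sub>R q x"
      using qsc0[of s x] qsc0[of "- s" x] qneg[of "s *\<^sub>R x"] by (cases "s \<ge> 0") auto
  qed (rule qplus)
qed

theorem Hahn_Banach_sublinear:
  fixes p :: "'b::real_vector \<Rightarrow> real"
  assumes p: "sublinear p"
  obtains L where "linear L" "\<And>x. L x \<le> p x"
proof -
  let ?A = "{q. sublinear q \<and> q \<le> p}"
  \<comment> \<open>The order is reversed: Zorn's maximal elements are the pointwise minimal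
    sublinear functions below \<open>p\<close>.\<close>
  let ?P = "\<lambda>q r :: 'b \<Rightarrow> real. q \<ge> r"
  have "\<exists>m\<in>?A. \<forall>a\<in>?A. ?P m a \<longrightarrow> a = m"
  proof (rule predicate_Zorn)
    show "partial_order_on ?A (relation_of ?P ?A)"
      by (rule partial_order_on_relation_ofI) auto
  next
    fix C assume "C \<in> Chains (relation_of ?P ?A)"
    then have CA: "C \<subseteq> ?A" and chain: "\<And>q r. q \<in> C \<Longrightarrow> r \<in> C \<Longrightarrow> q \<le> r \<or> r \<le> q"
      unfolding Chains_def relation_of_def by auto
    show "\<exists>u\<in>?A. \<forall>a\<in>C. ?P a u"
    proof (cases "C = {}")
      case True
      then show ?thesis using p by auto
    next
      case False
      let ?u = "\<lambda>x. INF q\<in>C. q x"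
      have bdd: "bdd_below ((\<lambda>q. q x) ` C)" for x
      proof (rule bdd_belowI)
        fix y assume "y \<in> (\<lambda>q. q x) ` C"
        then obtain q where "q \<in> C" "y = q x" by auto
        then have "- p (- x) \<le> - q (- x)" "- q (- x) \<le> y"
          using CA sublinear_minus[of q x] by (auto simp: le_fun_def)
        then show "- p (- x) \<le> y" by linarith
      qed
      have "sublinear ?u"
      proof (rule sublinear_INF[OF False bdd])
        fix q r x y assume "q \<in> C" "r \<in> C"
        then obtain k where k: "k \<in> C" "k \<le> q" "k \<le> r" using chain by blast
        then have "k (x + y) \<le> k x + k y" using CA unfolding sublinear_def by auto
        then show "\<exists>k\<in>C. k (x + y) \<le> q x + r y"
          using k by (intro bexI[of _ k]) (auto simp: le_fun_def intro: order_trans[OF _ add_mono])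
      next
        fix q s x assume "q \<in> C" "(0::real) < s"
        then show "\<exists>k\<in>C. k (s *\<^sub>R x) \<le> s * q x"
          using CA unfolding sublinear_def by (intro bexI[of _ q]) auto
      qed
      moreover have low: "?u \<le> q" if "q \<in> C" for q
        using cINF_lower[OF bdd that] by (simp add: le_fun_def)
      moreover have "?u \<le> p" 
      proof -
        obtain q where "q \<in> C" using False by blast
        then show ?thesis using low[of q] CA by (auto intro: order_trans)
      qed
      ultimately show ?thesis by (intro bexI[of _ ?u]) auto
    qed
  qed
  then obtain m where m: "sublinear m" "m \<le> p"
    and min: "\<And>a. sublinear a \<Longrightarrow> a \<le> p \<Longrightarrow> a \<le> m \<Longrightarrow> a = m" by blast
  have "linear m"
  proof (rule minimal_sublinear_linear[OF m(1)])
    fix r assume "sublinear r" "\<And>x. r x \<le> m x"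
    then show "r = m" using m(2) by (intro min) (auto simp: le_fun_def intro: order_trans)
  qed
  then show thesis using that m(2) by (auto simp: le_fun_def)
qed

text \<open>Here \<open>H\<close> plays the role of the epigraph of a convex function \<open>g\<close>; if \<open>f + g \<ge> \<eta>\<close>, then
  some linear \<open>L\<close> satisfies \<open>- f\<^sup>*(L) - g\<^sup>*(- L) \<ge> \<eta>\<close>.\<close>

lemma Fenchel_duality:
  fixes f :: "'b::real_vector \<Rightarrow> real" and H :: "('b \<times> real) set"
  assumes f: "convex_on UNIV f" and H: "convex H" "H \<noteq> {}"
    and ge: "\<And>v r. (v, r) \<in> H \<Longrightarrow> \<eta> \<le> f v + r"
  obtains L where "linear L" "\<forall>z. \<forall>(v, r)\<in>H. \<eta> \<le> f z - L z + r + L v"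
proof -
  \<comment> \<open>The factor \<open>s > 0\<close> makes the infimum of these quotients over
    \<open>I\<close> positively homogeneous. Once \<open>L\<close> lies below it,
    \<open>s = 1\<close> and \<open>w = z - v\<close> give the claim.\<close>
  define g where "g = (\<lambda>(s, v, r) w. (f (s *\<^sub>R w + v) + r - \<eta>) / s)"
  define I where "I = {0::real<..} \<times> H"
  have mix: "\<exists>k\<in>I. g k (x + y) \<le> g i x + g j y" if ij: "i \<in> I" "j \<in> I" for i j x y
  proof -
    obtain s v r where i: "i = (s, v, r)" "s > 0" "(v, r) \<in> H" using ij(1) unfolding I_def by auto
    obtain s' v' r' where j: "j = (s', v', r')" "s' > 0" "(v', r') \<in> H" using ij(2) unfolding I_def by auto
    \<comment> \<open>These weights satisfy \<open>a * s = b * s' = S\<close>, so the convex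
      combination of the two arguments of \<open>f\<close> is the argument that belongs to
      \<open>S\<close> and \<open>x + y\<close>.\<close>
    define a where "a = s' / (s + s')"
    define b where "b = s / (s + s')"
    define S where "S = s * s' / (s + s')"
    have ab: "a > 0" "b > 0" "a + b = 1" and S: "S > 0" "S = a * s" "S = b * s'"
      using i(2) j(2) add_pos_pos[OF i(2) j(2)] unfolding a_def b_def S_def
      by (auto simp: add_divide_distrib[symmetric] add.commute)
    have mem: "(a *\<^sub>R v + b *\<^sub>R v', a * r + b * r') \<in> H"
      using convexD[OF H(1) i(3) j(3), of a b] ab by simp
    have "S *\<^sub>R (x + y) + (a *\<^sub>R v + b *\<^sub>R v') = a *\<^sub>R (s *\<^sub>R x + v) + b *\<^sub>R (s' *\<^sub>R y + v')"
      using S(2,3)[symmetric] by (simp add: scaleR_add_right)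
    then have "f (S *\<^sub>R (x + y) + (a *\<^sub>R v + b *\<^sub>R v')) \<le> a * f (s *\<^sub>R x + v) + b * f (s' *\<^sub>R y + v')"
      using f ab unfolding convex_on_def by simp
    moreover have "\<eta> = a * \<eta> + b * \<eta>" using ab(3) by (metis distrib_right mult_1)
    ultimately have "g (S, a *\<^sub>R v + b *\<^sub>R v', a * r + b * r') (x + y)
        \<le> (a * (f (s *\<^sub>R x + v) + r - \<eta>) + b * (f (s' *\<^sub>R y + v') + r' - \<eta>)) / S"
      unfolding g_def using S(1) by (auto intro!: divide_right_mono simp: algebra_simps)
    also have "\<dots> = a * (f (s *\<^sub>R x + v) + r - \<eta>) / (a * s) + b * (f (s' *\<^sub>R y + v') + r' - \<eta>) / (b * s')"
      using S(2,3) by (simp add: add_divide_distrib)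
    also have "\<dots> = g i x + g j y"
      unfolding g_def i j using ab by simp
    finally show ?thesis using mem S(1) unfolding I_def by blast
  qed
  have zero: "0 \<le> g i 0" if "i \<in> I" for i
    using that ge unfolding I_def g_def by fastforce
  obtain i0 where i0: "i0 \<in> I" using H(2) unfolding I_def by fastforce
  \<comment> \<open>Adding the fixed member \<open>i0\<close> at \<open>- x\<close> leads, by
    \<open>mix\<close>, to some member at \<open>0\<close>, which is nonnegative.\<close>
  have bdd: "bdd_below ((\<lambda>i. g i x) ` I)" for x
  proof (rule bdd_belowI)
    fix y assume "y \<in> (\<lambda>i. g i x) ` I"
    then obtain i where "i \<in> I" "y = g i x" by auto
    then show "- g i0 (- x) \<le> y" using mix[OF _ i0, of i x "- x"] zero by fastforce
  qed
  have "sublinear (\<lambda>x. INF i\<in>I. g i x)"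
  proof (rule sublinear_INF)
    show "I \<noteq> {}" using i0 by blast
    show "bdd_below ((\<lambda>i. g i x) ` I)" for x by (rule bdd)
    fix i s x assume "i \<in> I" "(0::real) < s"
    then show "\<exists>k\<in>I. g k (s *\<^sub>R x) \<le> s * g i x"
      by (intro bexI[of _ "(fst i / s, snd i)"]) (auto simp: I_def g_def field_simps)
  qed (rule mix)
  then obtain L where L: "linear L" "\<And>x. L x \<le> (INF i\<in>I. g i x)" 
    using Hahn_Banach_sublinear by blast
  show thesis
  proof (rule that[OF L(1)], clarify)
    fix z v r assume "(v, r) \<in> H"
    then have "(1, v, r) \<in> I" unfolding I_def by simp
    then have "L (z - v) \<le> g (1, v, r) (z - v)" using L(2) cINF_lower[OF bdd] by (meson order_trans)
    then show "\<eta> \<le> f z - L z + r + L v" using linear_diff[OF L(1)] unfolding g_def by simp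
  qed
qed

section \<open>The duality product\<close>

definition duality_prod :: "'a::real_normed_vector \<times> ('a \<Rightarrow>\<^sub>L real) \<Rightarrow> real" where
  "duality_prod p = blinfun_apply (snd p) (fst p)"

lemma duality_prod_zero [simp]: "duality_prod 0 = 0"
  by (simp add: duality_prod_def)

lemma tendsto_duality_prod [tendsto_intros]:
  "(g \<longlongrightarrow> p) F \<Longrightarrow> ((\<lambda>x. duality_prod (g x)) \<longlongrightarrow> duality_prod p) F"
  unfolding duality_prod_def by (intro tendsto_intros)

text \<open>The norm on the product is Euclidean, so half its square splits into the two components.
  The bounds on the duality product and the componentwise conjugation below rest on this.\<close>

lemma norm_prod_square: "(norm p)\<^sup>2 = (norm (fst p))\<^sup>2 + (norm (snd p))\<^sup>2"
  by (simp add: norm_prod_def)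

lemma duality_prod_ge: "- ((norm p)\<^sup>2 / 2) \<le> duality_prod p"
  and duality_prod_le: "duality_prod p \<le> (norm p)\<^sup>2 / 2"
proof -
  have "\<bar>duality_prod p\<bar> \<le> norm (snd p) * norm (fst p)"
    unfolding duality_prod_def using norm_blinfun[of "snd p" "fst p"] by simp
  moreover have "2 * (norm (snd p) * norm (fst p)) \<le> (norm p)\<^sup>2"
    using sum_squares_bound[of "norm (snd p)" "norm (fst p)"] unfolding norm_prod_square by simp
  ultimately show "- ((norm p)\<^sup>2 / 2) \<le> duality_prod p" "duality_prod p \<le> (norm p)\<^sup>2 / 2"
    by linarith+
qed

lemma convex_on_half_norm_square: "convex_on UNIV (\<lambda>w::'b::real_normed_vector. (norm w)\<^sup>2 / 2)"
proof (rule convex_onI)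
  fix t :: real and x y :: 'b assume t: "0 < t" "t < 1"
  have "norm ((1 - t) *\<^sub>R x + t *\<^sub>R y) \<le> (1 - t) * norm x + t * norm y"
    using norm_triangle_ineq[of "(1 - t) *\<^sub>R x" "t *\<^sub>R y"] t by simp
  then have "(norm ((1 - t) *\<^sub>R x + t *\<^sub>R y))\<^sup>2 \<le> ((1 - t) * norm x + t * norm y)\<^sup>2"
    by (intro power_mono) auto
  also have "\<dots> = (1 - t) * (norm x)\<^sup>2 + t * (norm y)\<^sup>2 - t * (1 - t) * (norm x - norm y)\<^sup>2"
    by (simp add: power2_eq_square algebra_simps)
  also have "\<dots> \<le> (1 - t) * (norm x)\<^sup>2 + t * (norm y)\<^sup>2" using t by simp
  finally show "(norm ((1 - t) *\<^sub>R x + t *\<^sub>R y))\<^sup>2 / 2 \<le> (1 - t) * ((norm x)\<^sup>2 / 2) + t * ((norm y)\<^sup>2 / 2)"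
    by simp
qed simp

text \<open>Testing the hypothesis on the best multiple of each \<open>x\<close> bounds the operator
  norm of \<open>a\<close>. This is the lower bound in the formula for the conjugate of half the
  squared norm.\<close>

lemma half_norm_square_conjugate:
  fixes a :: "'b::real_normed_vector \<Rightarrow>\<^sub>L real"
  assumes "\<And>x. blinfun_apply a x - (norm x)\<^sup>2 / 2 \<le> m"
  shows "(norm a)\<^sup>2 / 2 \<le> m"
proof -
  have m: "0 \<le> m" using assms[of 0] by (simp add: blinfun.zero_right)
  have "norm (blinfun_apply a x) \<le> sqrt (2 * m) * norm x" for x
  proof (cases "x = 0")
    case False
    \<comment> \<open>This value maximises the quadratic
      \<open>s * a x - s\<^sup>2 * (norm x)\<^sup>2 / 2\<close> in \<open>s\<close>.\<close>
    let ?s = "blinfun_apply a x / (norm x)\<^sup>2"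
    have "blinfun_apply a (?s *\<^sub>R x) - (norm (?s *\<^sub>R x))\<^sup>2 / 2 = (blinfun_apply a x)\<^sup>2 / (norm x)\<^sup>2 / 2"
      using False by (simp add: blinfun.scaleR_right power_mult_distrib power_divide power2_eq_square field_simps)
    then have "(blinfun_apply a x)\<^sup>2 \<le> 2 * m * (norm x)\<^sup>2"
      using assms[of "?s *\<^sub>R x"] False by (simp only:) (simp add: field_simps)
    then have "sqrt ((blinfun_apply a x)\<^sup>2) \<le> sqrt (2 * m * (norm x)\<^sup>2)" by (rule real_sqrt_le_mono)
    then show ?thesis by (simp add: real_sqrt_mult)
  qed (simp add: blinfun.zero_right)
  then have "norm a \<le> sqrt (2 * m)" by (intro norm_blinfun_bound) (use m in auto)
  then have "(norm a)\<^sup>2 \<le> (sqrt (2 * m))\<^sup>2" by (intro power_mono) auto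
  then show ?thesis using m by simp
qed

section \<open>Approximate solutions for operators of type (D)\<close>

lemma monotone_op_iff_duality_prod: "monotone_op T \<longleftrightarrow> (\<forall>s\<in>T. \<forall>t\<in>T. 0 \<le> duality_prod (s - t))"
  unfolding monotone_op_def duality_prod_def by (simp add: case_prod_beta)

lemma maximal_monotone_memI:
  assumes T: "maximal_monotone T" and z: "\<And>t. t \<in> T \<Longrightarrow> 0 \<le> duality_prod (t - z)"
  shows "z \<in> T"
proof -
  have sym: "duality_prod (z - t) = duality_prod (t - z)" for t
    unfolding duality_prod_def by (simp add: blinfun.diff_left blinfun.diff_right algebra_simps)
  have "monotone_op (insert z T)"
    unfolding monotone_op_iff_duality_prod
  proof (intro ballI)
    fix s t assume st: "s \<in> insert z T" "t \<in> insert z T"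
    have "0 \<le> duality_prod (s - t)" if "s \<in> T" "t \<in> T"
      using T that unfolding maximal_monotone_def monotone_op_iff_duality_prod by blast
    moreover have "0 \<le> duality_prod (z - t)" if "t \<in> T" using z[OF that] sym by simp
    ultimately show "0 \<le> duality_prod (s - t)" using st z[of s] by auto
  qed
  then have "insert z T = T" using T unfolding maximal_monotone_def by blast
  then show ?thesis by blast
qed

lemma maximal_monotone_nonempty: "maximal_monotone T \<Longrightarrow> T \<noteq> {}"
  using maximal_monotone_memI by fastforce

text \<open>A positive \<open>c\<close> would put \<open>z\<close> into \<open>T\<close> by
  maximality, and then \<open>t = z\<close> gives a contradiction. With
  \<open>c = duality_prod p - r\<close> this says that the Fitzpatrick function dominates the
  duality product.\<close>

lemma maximal_monotone_duality_prod_le: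
  assumes T: "maximal_monotone T" and z: "\<And>t. t \<in> T \<Longrightarrow> c \<le> duality_prod (t - z)"
  shows "c \<le> 0"
proof (rule ccontr)
  assume c: "\<not> c \<le> 0"
  have "z \<in> T" using c z by (intro maximal_monotone_memI[OF T]) (meson order_trans linear)
  then show False using z[of z] c by simp
qed

text \<open>This is the negative infimum property (NI). A positive lower bound \<open>c\<close>
  would put \<open>(xss, xs)\<close> into \<open>tilde_op T\<close>; along the net of type (D) the
  pairing tends to 0, since \<open>xs - ys\<close> tends to 0 in norm while \<open>y\<close> stays
  bounded.\<close>

lemma type_D_imp_NI:
  assumes T: "type_D T" and c: "c > 0"
  shows "\<exists>(y, ys)\<in>T. blinfun_apply xss (xs - ys) - blinfun_apply (xs - ys) y < c"
proof (rule ccontr)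
  assume "\<not> ?thesis"
  then have far: "\<And>y ys. (y, ys) \<in> T \<Longrightarrow> c \<le> blinfun_apply xss (xs - ys) - blinfun_apply (xs - ys) y"
    by fastforce
  then have "(xss, xs) \<in> tilde_op T" using c unfolding tilde_op_def by fastforce
  then obtain F M where F: "F \<noteq> bot"
    and ev: "\<forall>\<^sub>F p in F. p \<in> T \<and> norm (fst p) \<le> M \<and> norm (snd p) \<le> M"
    and lim: "(snd \<longlongrightarrow> xs) F"
    using T unfolding type_D_def by fastforce
  have d: "((\<lambda>p. xs - snd p) \<longlongrightarrow> 0) F"
    using tendsto_diff[OF tendsto_const lim, of xs] by simp
  have 1: "((\<lambda>p. blinfun_apply xss (xs - snd p)) \<longlongrightarrow> 0) F"
    using blinfun.tendsto[OF tendsto_const d, of xss] by (simp add: blinfun.zero_right)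
  have 2: "((\<lambda>p. blinfun_apply (xs - snd p) (fst p)) \<longlongrightarrow> 0) F"
  proof (rule Lim_null_comparison)
    show "\<forall>\<^sub>F p in F. norm (blinfun_apply (xs - snd p) (fst p)) \<le> norm (xs - snd p) * M"
      using ev
    proof eventually_elim
      case (elim p)
      then show ?case
        using norm_blinfun[of "xs - snd p" "fst p"] mult_left_mono[of "norm (fst p)" M "norm (xs - snd p)"]
        by auto
    qed
    show "((\<lambda>p. norm (xs - snd p) * M) \<longlongrightarrow> 0) F"
      by (rule tendsto_mult_left_zero[OF tendsto_norm_zero[OF d]])
  qed
  have "((\<lambda>p. blinfun_apply xss (xs - snd p) - blinfun_apply (xs - snd p) (fst p)) \<longlongrightarrow> 0) F"
    using tendsto_diff[OF 1 2] by simp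
  moreover have "\<forall>\<^sub>F p in F. c \<le> blinfun_apply xss (xs - snd p) - blinfun_apply (xs - snd p) (fst p)"
    using ev by eventually_elim (use far in auto)
  ultimately have "c \<le> 0" using F by (rule tendsto_lowerbound)
  then show False using c by simp
qed

text \<open>\<open>fitz_epi T\<close> is the epigraph of the Fitzpatrick function
  \<open>\<phi>(q) = sup {\<langle>q\<rangle> - \<langle>t - q\<rangle> | t \<in> T}\<close>, where \<open>\<langle>x, x\<^sup>*\<rangle>\<close> is the duality product.\<close>

definition fitz_epi :: "('a::real_normed_vector \<times> ('a \<Rightarrow>\<^sub>L real)) set \<Rightarrow> (('a \<times> ('a \<Rightarrow>\<^sub>L real)) \<times> real) set"
  where "fitz_epi T = {(q, r). \<forall>t\<in>T. duality_prod q - r \<le> duality_prod (t - q)}"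

lemma convex_fitz_epi: "convex (fitz_epi T)"
proof (rule convexI)
  fix p q :: "('a \<times> ('a \<Rightarrow>\<^sub>L real)) \<times> real" and u v :: real
  assume p: "p \<in> fitz_epi T" and q: "q \<in> fitz_epi T" and uv: "0 \<le> u" "0 \<le> v" "u + v = 1"
  \<comment> \<open>Expanding \<open>duality_prod (t - q)\<close> cancels the term
    \<open>duality_prod q\<close>: membership becomes \<open>G t q \<le> r\<close> with
    \<open>G t\<close> affine, so the set is an intersection of half-spaces.\<close>
  define G where "G = (\<lambda>t p :: 'a \<times> ('a \<Rightarrow>\<^sub>L real).
    blinfun_apply (snd t) (fst p) + blinfun_apply (snd p) (fst t) - duality_prod t)"
  have iff: "p \<in> fitz_epi T \<longleftrightarrow> (\<forall>t\<in>T. G t (fst p) \<le> snd p)" for p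
    unfolding fitz_epi_def G_def duality_prod_def
    by (auto simp: blinfun.diff_left blinfun.diff_right algebra_simps split: prod.splits)
  have aff: "G t (u *\<^sub>R x + v *\<^sub>R y) = u * G t x + v * G t y" for t x y
  proof -
    have "duality_prod t = u * duality_prod t + v * duality_prod t"
      using uv(3) by (metis distrib_right mult_1)
    then show ?thesis unfolding G_def
      by (simp add: blinfun.add_left blinfun.add_right blinfun.scaleR_left blinfun.scaleR_right algebra_simps)
  qed
  show "u *\<^sub>R p + v *\<^sub>R q \<in> fitz_epi T"
    using p q uv unfolding iff by (auto simp: aff intro!: add_mono mult_left_mono)
qed

lemma fitz_epi_mono: "(p, r) \<in> fitz_epi T \<Longrightarrow> r \<le> s \<Longrightarrow> (p, s) \<in> fitz_epi T"
  unfolding fitz_epi_def by force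

lemma maximal_monotone_fitz_epi_ge:
  "maximal_monotone T \<Longrightarrow> (p, r) \<in> fitz_epi T \<Longrightarrow> duality_prod p \<le> r"
  using maximal_monotone_duality_prod_le[of T "duality_prod p - r" p] unfolding fitz_epi_def by auto

lemma monotone_op_graph_in_fitz_epi: "monotone_op T \<Longrightarrow> t \<in> T \<Longrightarrow> (t, duality_prod t) \<in> fitz_epi T"
  unfolding monotone_op_iff_duality_prod fitz_epi_def by simp

text \<open>After moving \<open>z0\<close> to the origin it suffices to find \<open>(v, r)\<close>
  in the hull \<open>H\<close> with \<open>(norm v)\<^sup>2 / 2 + r < \<eta>\<close>: lying in the
  Fitzpatrick epigraph controls the error at \<open>v\<close>, and \<open>- \<delta> \<le> r\<close>
  controls its norm. If there is none, Fenchel duality yields a functional that contradicts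
  NI.\<close>

lemma type_D_approximate_step:
  fixes T :: "('a::real_normed_vector \<times> ('a \<Rightarrow>\<^sub>L real)) set"
  assumes T: "type_D T" and z0: "\<And>t. t \<in> T \<Longrightarrow> - \<delta> \<le> duality_prod (t - z0)" and \<eta>: "\<eta> > 0"
  shows "\<exists>z. (\<forall>t\<in>T. - \<eta> \<le> duality_prod (t - z)) \<and> (dist z z0)\<^sup>2 < 2 * (\<delta> + \<eta>)"
proof -
  have mx: "maximal_monotone T" using T unfolding type_D_def by blast
  then have mon: "monotone_op T" unfolding maximal_monotone_def by blast
  define T' where "T' = (\<lambda>t. t - z0) ` T"
  define H where "H = convex hull ((\<lambda>t. (t, duality_prod t)) ` T')"
  have mon': "monotone_op T'"
    using mon unfolding T'_def monotone_op_iff_duality_prod by simp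
  have shift: "(\<forall>t\<in>T'. c \<le> duality_prod (t - z)) \<longleftrightarrow> (\<forall>t\<in>T. c \<le> duality_prod (t - (z0 + z)))" for c z
    unfolding T'_def by (auto simp: diff_diff_eq)
  have H_epi: "H \<subseteq> fitz_epi T'"
    unfolding H_def by (intro hull_minimal) (use monotone_op_graph_in_fitz_epi[OF mon'] convex_fitz_epi in auto)
  have "convex (UNIV \<times> {- \<delta>..} :: (('a \<times> ('a \<Rightarrow>\<^sub>L real)) \<times> real) set)"
    by (intro convex_Times convex_real_interval convex_UNIV)
  then have "H \<subseteq> UNIV \<times> {- \<delta>..}"
    unfolding H_def by (intro hull_minimal) (use z0 in \<open>auto simp: T'_def\<close>)
  then have H_low: "- \<delta> \<le> r" if "(v, r) \<in> H" for v r using that by auto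
  have "\<exists>(v, r)\<in>H. (norm v)\<^sup>2 / 2 + r < \<eta>"
  proof (rule ccontr)
    assume "\<not> ?thesis"
    then have big: "\<And>v r. (v, r) \<in> H \<Longrightarrow> \<eta> \<le> (norm v)\<^sup>2 / 2 + r" by fastforce
    have convex_H: "convex H" unfolding H_def by (rule convex_convex_hull)
    have Hne: "H \<noteq> {}" using maximal_monotone_nonempty[OF mx] unfolding H_def T'_def by auto
    obtain L where L: "linear L"
      and "\<forall>z. \<forall>(v, r)\<in>H. \<eta> \<le> (norm z)\<^sup>2 / 2 - L z + r + L v"
      by (rule Fenchel_duality[OF convex_on_half_norm_square convex_H Hne big])
    then have LH: "\<eta> \<le> (norm z)\<^sup>2 / 2 - L z + r + L v" if "(v, r) \<in> H" for z v r
      using that by blast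
    obtain v0 r0 where vr0: "(v0, r0) \<in> H" using Hne by auto
    \<comment> \<open>\<open>L\<close> comes from Hahn-Banach and is so far only linear. The duality
      inequality at one fixed point of \<open>H\<close>, with \<open>norm w = 1\<close>, bounds it
      on the unit sphere, which gives continuity.\<close>
    define K where "K = 1/2 + \<bar>r0 + L v0 - \<eta>\<bar>"
    have unit: "L w \<le> K" if "norm w = 1" for w
      using LH[OF vr0, of w] that unfolding K_def by simp
    have Lbound: "norm (L w) \<le> norm w * K" for w
    proof (cases "w = 0")
      case True
      then show ?thesis using linear_0[OF L] by simp
    next
      case False
      let ?u = "inverse (norm w) *\<^sub>R w"
      have u: "norm ?u = 1" using False by simp
      have "L ?u \<le> K" "L (- ?u) \<le> K" using u by (auto intro!: unit)
      then have "\<bar>L ?u\<bar> \<le> K" using linear_neg[OF L, of ?u] by linarith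
      then have "norm w * \<bar>L ?u\<bar> \<le> norm w * K" by (intro mult_left_mono) auto
      moreover have "L w = norm w * L ?u" using False linear_scale[OF L, of "inverse (norm w)" w] by simp
      ultimately show ?thesis by (simp only: real_norm_def abs_mult abs_norm_cancel)
    qed
    have BL: "bounded_linear L"
      using L Lbound unfolding bounded_linear_def bounded_linear_axioms_def by blast
    define a where "a = Blinfun (\<lambda>x. L (x, 0))"
    define b where "b = Blinfun (\<lambda>xs. L (0, xs))"
    have a: "blinfun_apply a x = L (x, 0)" for x
      unfolding a_def by (subst bounded_linear_Blinfun_apply)
        (auto intro!: bounded_linear_compose[OF BL] bounded_linear_Pair bounded_linear_ident bounded_linear_zero)
    have b: "blinfun_apply b xs = L (0, xs)" for xs
      unfolding b_def by (subst bounded_linear_Blinfun_apply)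
        (auto intro!: bounded_linear_compose[OF BL] bounded_linear_Pair bounded_linear_ident bounded_linear_zero)
    have Lab: "L (x, xs) = blinfun_apply a x + blinfun_apply b xs" for x xs
      unfolding a b using linear_add[OF L, of "(x, 0)" "(0, xs)"] by simp
    \<comment> \<open>Taking the supremum over \<open>x\<close> and then over \<open>xs\<close> puts
      the duality inequality into conjugate form.\<close>
    have conj: "(norm a)\<^sup>2 / 2 + (norm b)\<^sup>2 / 2 \<le> r + L v - \<eta>" if "(v, r) \<in> H" for v r
    proof -
      have 1: "blinfun_apply a x - (norm x)\<^sup>2 / 2 \<le> r + L v - \<eta> + (norm xs)\<^sup>2 / 2 - blinfun_apply b xs" for x xs
        using LH[OF that, of "(x, xs)"] unfolding norm_prod_square Lab by (simp add: add_divide_distrib)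
      have 2: "blinfun_apply b xs - (norm xs)\<^sup>2 / 2 \<le> r + L v - \<eta> - (norm a)\<^sup>2 / 2" for xs
        using half_norm_square_conjugate[OF 1, of xs] by linarith
      show ?thesis using half_norm_square_conjugate[OF 2] by linarith
    qed
    obtain x0 xs0 where z0_eq: "z0 = (x0, xs0)" by (cases z0)
    define j where "j = Blinfun (\<lambda>f::'a \<Rightarrow>\<^sub>L real. blinfun_apply f x0)"
    have j: "blinfun_apply j f = blinfun_apply f x0" for f
      unfolding j_def by (subst bounded_linear_Blinfun_apply) (rule blinfun.bounded_linear_left, simp)
    obtain y ys where y: "(y, ys) \<in> T"
      and less: "blinfun_apply (j - b) (xs0 - a - ys) - blinfun_apply (xs0 - a - ys) y < \<eta>"
      using type_D_imp_NI[OF T \<eta>, of "j - b" "xs0 - a"] by auto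
    let ?v = "(y - x0, ys - xs0)"
    have "(?v, duality_prod ?v) \<in> H"
      unfolding H_def T'_def z0_eq using y by (intro hull_inc) force
    from conj[OF this] have "(norm a)\<^sup>2 / 2 + (norm b)\<^sup>2 / 2 \<le> duality_prod ?v + L ?v - \<eta>" .
    also have "duality_prod ?v + L ?v =
        blinfun_apply (j - b) (xs0 - a - ys) - blinfun_apply (xs0 - a - ys) y - blinfun_apply b a"
      unfolding Lab duality_prod_def
      by (simp add: blinfun.diff_left blinfun.diff_right j)
    also have "\<dots> - \<eta> < - blinfun_apply b a" using less by simp
    \<comment> \<open>The bound on the duality product is applied one level up, to the dual and the
      bidual.\<close>
    also have "- blinfun_apply b a \<le> (norm a)\<^sup>2 / 2 + (norm b)\<^sup>2 / 2"
      using duality_prod_ge[of "(a, b)"] unfolding norm_prod_square by (simp add: duality_prod_def add_divide_distrib)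
    finally show False by simp
  qed
  then obtain v r where v: "(v, r) \<in> H" "(norm v)\<^sup>2 / 2 + r < \<eta>" by auto
  have "\<forall>t\<in>T'. duality_prod v - r \<le> duality_prod (t - v)"
    using v(1) H_epi unfolding fitz_epi_def by auto
  \<comment> \<open>Since \<open>duality_prod v\<close> is at least
    \<open>- ((norm v)\<^sup>2 / 2)\<close>, the error at \<open>v\<close> is at most
    \<open>(norm v)\<^sup>2 / 2 + r\<close>.\<close>
  then have "\<forall>t\<in>T'. - \<eta> \<le> duality_prod (t - v)"
    using v(2) duality_prod_ge[of v] by force
  moreover have "(dist (z0 + v) z0)\<^sup>2 < 2 * (\<delta> + \<eta>)"
    using v(2) H_low[OF v(1)] by (simp add: dist_norm)
  ultimately show ?thesis unfolding shift by blast
qed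

text \<open>Dividing the error by 4 at each step halves the bound on the step length, so the
  iterates converge, and the limit has error 0. The constant 4 is the same for all \<open>T\<close>,
  which allows use along a sequence of operators.\<close>

lemma type_D_Bronsted_Rockafellar:
  fixes T :: "('a::banach \<times> ('a \<Rightarrow>\<^sub>L real)) set"
  assumes T: "type_D T" and \<delta>: "\<delta> > 0" and z0: "\<And>t. t \<in> T \<Longrightarrow> - \<delta> \<le> duality_prod (t - z0)"
  shows "\<exists>t\<in>T. dist t z0 \<le> 4 * sqrt \<delta>"
proof -
  let ?P = "\<lambda>n z. (\<forall>t\<in>T. - (\<delta> / 4 ^ n) \<le> duality_prod (t - z)) \<and> (n = 0 \<longrightarrow> z = z0)"
  let ?Q = "\<lambda>n z z'. dist z' z \<le> 2 * sqrt \<delta> * (1 / 2) ^ n"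
  have "\<exists>z. \<forall>n. ?P n (z n) \<and> ?Q n (z n) (z (Suc n))"
  proof (rule dependent_nat_choice)
    show "\<exists>z. ?P 0 z" using z0 by (intro exI[of _ z0]) simp
  next
    fix z n assume P: "?P n z"
    obtain z' where z': "\<forall>t\<in>T. - (\<delta> / 4 ^ Suc n) \<le> duality_prod (t - z')"
      and d: "(dist z' z)\<^sup>2 < 2 * (\<delta> / 4 ^ n + \<delta> / 4 ^ Suc n)"
      using type_D_approximate_step[OF T, of "\<delta> / 4 ^ n" z "\<delta> / 4 ^ Suc n"] P \<delta> by auto
    \<comment> \<open>The factor \<open>2 * (1 + 1 / 4) = 5 / 2\<close> is rounded up to 4, so that
      the root is \<open>2 * sqrt \<delta> / 2 ^ n\<close>, with sum
      \<open>4 * sqrt \<delta>\<close>.\<close>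
    have "2 * (\<delta> / 4 ^ n + \<delta> / 4 ^ Suc n) \<le> 4 * (\<delta> / 4 ^ n)"
      using \<delta> by (simp add: field_simps)
    also have "\<dots> = (2 * sqrt \<delta> * (1 / 2) ^ n)\<^sup>2"
    proof -
      have "(4::real) ^ n = (2 ^ n)\<^sup>2" by (simp add: power2_eq_square flip: power_mult_distrib)
      then show ?thesis using \<delta> by (simp add: power_mult_distrib power_divide)
    qed
    finally have "(dist z' z)\<^sup>2 \<le> (2 * sqrt \<delta> * (1 / 2) ^ n)\<^sup>2" using d by linarith
    then have "?Q n z z'" by (rule power2_le_imp_le) (use \<delta> in auto)
    then show "\<exists>z'. ?P (Suc n) z' \<and> ?Q n z z'" using z' by (intro exI[of _ z']) simp
  qed
  then obtain z where P: "\<And>n. ?P n (z n)" and Q: "\<And>n. ?Q n (z n) (z (Suc n))" by blast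
  let ?d = "\<lambda>n. z (Suc n) - z n" and ?g = "\<lambda>n. 2 * sqrt \<delta> * (1 / 2) ^ n"
  have le: "norm (?d n) \<le> ?g n" for n using Q[of n] by (simp add: dist_norm)
  have g: "summable ?g" by (intro summable_mult summable_geometric) simp
  \<comment> \<open>Completeness of the product space turns summable step lengths into
    convergence.\<close>
  have sumd: "summable ?d" by (rule summable_comparison_test'[OF g]) (rule le)
  have "norm (suminf ?d) \<le> suminf ?g" by (rule norm_suminf_le[OF le g])
  also have "suminf ?g = 4 * sqrt \<delta>" by (subst suminf_mult) (auto simp: suminf_geometric)
  finally have small: "norm (suminf ?d) \<le> 4 * sqrt \<delta>" .
  have "(\<lambda>n. z 0 + sum ?d {..<n}) \<longlonglongrightarrow> z 0 + suminf ?d"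
    by (intro tendsto_intros summable_LIMSEQ sumd)
  then have lim: "z \<longlonglongrightarrow> z0 + suminf ?d"
    using P[of 0] by (simp add: sum_lessThan_telescope)
  have "z0 + suminf ?d \<in> T"
  proof (rule maximal_monotone_memI)
    show "maximal_monotone T" using T unfolding type_D_def by blast
    fix t assume t: "t \<in> T"
    have "(\<lambda>n. - (\<delta> * (1 / 4) ^ n)) \<longlonglongrightarrow> - (\<delta> * 0)" by (intro tendsto_intros LIMSEQ_power_zero) simp
    moreover have "(\<lambda>n. duality_prod (t - z n)) \<longlonglongrightarrow> duality_prod (t - (z0 + suminf ?d))"
      by (intro tendsto_intros lim)
    ultimately show "0 \<le> duality_prod (t - (z0 + suminf ?d))"
      using P t by (auto intro!: LIMSEQ_le simp: power_divide)
  qed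
  then show ?thesis using small by (intro bexI[of _ "z0 + suminf ?d"]) (auto simp: dist_norm)
qed

section \<open>Lower limits and representability\<close>

text \<open>Closedness makes the infimum of each nonempty fibre of \<open>A\<close> attained, so
  \<open>A\<close> is exactly the epigraph of \<open>h\<close>, and the required properties of
  \<open>h\<close> are read off from \<open>A\<close>.\<close>

lemma representable_if_epigraph:
  fixes A :: "(('a::real_normed_vector \<times> ('a \<Rightarrow>\<^sub>L real)) \<times> real) set"
  assumes A: "closed A" "convex A" "A \<noteq> {}"
    and up: "\<And>p r s. (p, r) \<in> A \<Longrightarrow> r \<le> s \<Longrightarrow> (p, s) \<in> A"
    and ge: "\<And>p r. (p, r) \<in> A \<Longrightarrow> duality_prod p \<le> r"
  shows "representable {p. (p, duality_prod p) \<in> A}"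
proof -
  \<comment> \<open>An empty fibre gets \<open>\<infinity>\<close> explicitly, because a real
    \<open>Inf\<close> cannot supply this value.\<close>
  define h where "h = (\<lambda>p. if \<exists>r. (p, r) \<in> A then ereal (Inf {r. (p, r) \<in> A}) else \<infinity>)"
  have epi: "(p, r) \<in> A \<longleftrightarrow> h p \<le> ereal r" for p r
  proof (cases "\<exists>r. (p, r) \<in> A")
    case True
    have bdd: "bdd_below {r. (p, r) \<in> A}" using ge by (intro bdd_belowI[of _ "duality_prod p"]) auto
    have "closed ((\<lambda>r. (p, r)) -` A)" by (intro closed_vimage A continuous_intros)
    then have "closed {r. (p, r) \<in> A}" by (simp add: vimage_def)
    then have "(p, Inf {r. (p, r) \<in> A}) \<in> A" using closed_contains_Inf[OF _ bdd] True by auto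
    then have "(p, r) \<in> A \<longleftrightarrow> Inf {r. (p, r) \<in> A} \<le> r" using up cInf_lower[OF _ bdd] by blast
    then show ?thesis using True unfolding h_def by simp
  qed (auto simp: h_def)
  have h_ge: "ereal (duality_prod p) \<le> h p" for p
    using ge[of p] epi[of p] by (cases "h p") (auto, use h_def in \<open>simp split: if_splits\<close>)
  have h_ninf: "h p \<noteq> - \<infinity>" for p using h_ge[of p] by auto
  have "ereal_convex h"
    unfolding ereal_convex_def
  proof (intro allI impI)
    fix p q and t :: real assume t: "0 < t \<and> t < 1"
    show "h (t *\<^sub>R p + (1 - t) *\<^sub>R q) \<le> ereal t * h p + ereal (1 - t) * h q"
    proof (cases "h p = \<infinity> \<or> h q = \<infinity>")
      case True
      then show ?thesis using t h_ninf[of p] h_ninf[of q] by (cases "h p"; cases "h q") auto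
    next
      case False
      then obtain r s where rs: "h p = ereal r" "h q = ereal s"
        using h_ninf by (metis ereal_cases)
      then have "(p, r) \<in> A" "(q, s) \<in> A" unfolding epi by auto
      then have "t *\<^sub>R (p, r) + (1 - t) *\<^sub>R (q, s) \<in> A" using t by (intro convexD[OF A(2)]) auto
      then show ?thesis unfolding rs using epi by simp
    qed
  qed
  moreover have "ereal_proper h"
  proof -
    obtain p r where "(p, r) \<in> A" using A(3) by auto
    then have "h p \<noteq> \<infinity>" unfolding epi by auto
    then show ?thesis using h_ninf unfolding ereal_proper_def by blast
  qed
  moreover have "ereal_lsc h"
    unfolding ereal_lsc_def
  proof (intro allI impI)
    fix p c assume "c < h p"
    \<comment> \<open>A real level is chosen in between, since \<open>c\<close> may be
      \<open>- \<infinity>\<close> while \<open>A\<close> has only real heights.\<close>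
    then obtain c' where c': "c < ereal c'" "ereal c' < h p" using ereal_dense2 by blast
    let ?U = "(\<lambda>q. (q, c')) -` (- A)"
    have "open ?U" using A(1) by (intro open_vimage continuous_intros) auto
    moreover have "p \<in> ?U" using c'(2) epi by auto
    moreover have "c < h q" if "q \<in> ?U" for q using that c'(1) epi by (auto intro: less_trans)
    ultimately show "\<forall>\<^sub>F q in at p. c < h q" unfolding eventually_at_topological by blast
  qed
  moreover have "{p. (p, duality_prod p) \<in> A} = {(x, xs). h (x, xs) = ereal (blinfun_apply xs x)}"
    using h_ge unfolding epi by (auto simp: duality_prod_def intro: antisym)
  ultimately show ?thesis
    using h_ge unfolding representable_def by (intro exI[of _ h]) (auto simp: duality_prod_def)
qed

text \<open>Half the squared norm plus 1 stays strictly above the duality product. This covers an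
  empty limit of epigraphs, whose function would be identically \<open>\<infinity>\<close> and hence
  not proper.\<close>

lemma representable_empty: "representable ({} :: ('a::real_normed_vector \<times> ('a \<Rightarrow>\<^sub>L real)) set)"
proof -
  let ?A = "{q :: ('a \<times> ('a \<Rightarrow>\<^sub>L real)) \<times> real. (norm (fst q))\<^sup>2 / 2 + 1 \<le> snd q}"
  have "convex ?A"
  proof (rule convexI)
    fix p q :: "('a \<times> ('a \<Rightarrow>\<^sub>L real)) \<times> real" and u v :: real
    assume pq: "p \<in> ?A" "q \<in> ?A" and uv: "0 \<le> u" "0 \<le> v" "u + v = 1"
    have "(norm (u *\<^sub>R fst p + v *\<^sub>R fst q))\<^sup>2 / 2 \<le> u * ((norm (fst p))\<^sup>2 / 2) + v * ((norm (fst q))\<^sup>2 / 2)"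
      using convex_on_half_norm_square uv unfolding convex_on_def by blast
    moreover have "u * ((norm (fst p))\<^sup>2 / 2 + 1) + v * ((norm (fst q))\<^sup>2 / 2 + 1) \<le> u * snd p + v * snd q"
      using pq uv by (intro add_mono mult_left_mono) auto
    ultimately show "u *\<^sub>R p + v *\<^sub>R q \<in> ?A" using uv(3) by (simp add: distrib_left)
  qed
  moreover have "closed ?A" by (intro closed_Collect_le continuous_intros) simp
  moreover have "(0, 1) \<in> ?A" by simp
  moreover have "duality_prod p < r" if "(p, r) \<in> ?A" for p r
    using that duality_prod_le[of p] by simp
  ultimately have "representable {p. (p, duality_prod p) \<in> ?A}"
    by (intro representable_if_epigraph) (auto intro: less_imp_le)
  moreover have "{p :: 'a \<times> ('a \<Rightarrow>\<^sub>L real). (p, duality_prod p) \<in> ?A} = {}"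
    using \<open>\<And>r p. (p, r) \<in> ?A \<Longrightarrow> duality_prod p < r\<close> by blast
  ultimately show ?thesis by (simp only:)
qed

text \<open>The Painleve-Kuratowski lower limit. In this form closedness and convexity follow
  without choosing sequences; the description by sequences is derived for nonempty sets.\<close>

definition lower_limit :: "(nat \<Rightarrow> 'b::metric_space set) \<Rightarrow> 'b set" where
  "lower_limit S = {w. \<forall>e>0. \<forall>\<^sub>F n in sequentially. \<exists>a\<in>S n. dist a w < e}"

lemma closed_lower_limit: "closed (lower_limit S)"
proof (rule closure_subset_eq[THEN iffD1], rule subsetI)
  fix w assume "w \<in> closure (lower_limit S)"
  then have w: "\<forall>e>0. \<exists>y\<in>lower_limit S. dist y w < e" by (simp add: closure_approachable)
  show "w \<in> lower_limit S"
    unfolding lower_limit_def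
  proof (intro CollectI allI impI)
    fix e :: real assume e: "e > 0"
    then obtain y where y: "y \<in> lower_limit S" "dist y w < e / 2" using w half_gt_zero by blast
    then have "\<forall>\<^sub>F n in sequentially. \<exists>a\<in>S n. dist a y < e / 2"
      using e unfolding lower_limit_def by (blast dest: half_gt_zero)
    then show "\<forall>\<^sub>F n in sequentially. \<exists>a\<in>S n. dist a w < e"
      by eventually_elim (use y(2) dist_triangle_half_r in \<open>metis dist_commute\<close>)
  qed
qed

lemma convex_lower_limit:
  fixes S :: "nat \<Rightarrow> 'b::real_normed_vector set"
  assumes "\<And>n. convex (S n)"
  shows "convex (lower_limit S)"
proof (rule convexI)
  fix p q :: 'b and u v :: real
  assume p: "p \<in> lower_limit S" and q: "q \<in> lower_limit S" and uv: "0 \<le> u" "0 \<le> v" "u + v = 1"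
  show "u *\<^sub>R p + v *\<^sub>R q \<in> lower_limit S"
    unfolding lower_limit_def
  proof (intro CollectI allI impI)
    fix e :: real assume e: "e > 0"
    have "\<forall>\<^sub>F n in sequentially. \<exists>a\<in>S n. dist a p < e" "\<forall>\<^sub>F n in sequentially. \<exists>a\<in>S n. dist a q < e"
      using p q e unfolding lower_limit_def by auto
    then show "\<forall>\<^sub>F n in sequentially. \<exists>a\<in>S n. dist a (u *\<^sub>R p + v *\<^sub>R q) < e"
    proof eventually_elim
      case (elim n)
      then obtain a b where ab: "a \<in> S n" "dist a p < e" "b \<in> S n" "dist b q < e" by blast
      have "u *\<^sub>R a + v *\<^sub>R b - (u *\<^sub>R p + v *\<^sub>R q) = u *\<^sub>R (a - p) + v *\<^sub>R (b - q)"
        by (simp add: algebra_simps)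
      then have "dist (u *\<^sub>R a + v *\<^sub>R b) (u *\<^sub>R p + v *\<^sub>R q) \<le> u * dist a p + v * dist b q"
        using norm_triangle_ineq[of "u *\<^sub>R (a - p)" "v *\<^sub>R (b - q)"] uv by (simp add: dist_norm)
      also have "\<dots> < e" using ab uv by (intro convex_bound_lt) auto
      finally show ?case using convexD[OF assms ab(1,3) uv] by blast
    qed
  qed
qed

lemma lower_limit_iff_sequence:
  assumes ne: "\<And>n. S n \<noteq> {}"
  shows "w \<in> lower_limit S \<longleftrightarrow> (\<exists>s. (\<forall>n. s n \<in> S n) \<and> s \<longlonglongrightarrow> w)"
proof
  assume w: "w \<in> lower_limit S"
  \<comment> \<open>One sequence has to serve all \<open>e\<close> at once, so nearly closest points
    are chosen. The vanishing slack allows for a distance that is not attained.\<close>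
  have "\<exists>a\<in>S n. dist w a < infdist w (S n) + 1 / real (Suc n)" for n
  proof -
    have "infdist w (S n) < infdist w (S n) + 1 / real (Suc n)" by simp
    then have "\<exists>d\<in>dist w ` S n. d < infdist w (S n) + 1 / real (Suc n)"
      using ne[of n] cInf_lessD[of "dist w ` S n"] unfolding infdist_notempty[OF ne] by blast
    then show ?thesis by blast
  qed
  then obtain s where s: "\<And>n. s n \<in> S n" "\<And>n. dist w (s n) < infdist w (S n) + 1 / real (Suc n)" by metis
  have "(\<lambda>n. infdist w (S n)) \<longlonglongrightarrow> 0"
  proof (rule tendstoI)
    fix e :: real assume "e > 0"
    then have "\<forall>\<^sub>F n in sequentially. \<exists>a\<in>S n. dist a w < e" using w unfolding lower_limit_def by blast
    then show "\<forall>\<^sub>F n in sequentially. dist (infdist w (S n)) 0 < e"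
    proof eventually_elim
      case (elim n)
      then obtain a where "a \<in> S n" "dist a w < e" by blast
      then show ?case using infdist_le[of a "S n" w] infdist_nonneg[of w "S n"] by (simp add: dist_commute)
    qed
  qed
  then have "(\<lambda>n. infdist w (S n) + 1 / real (Suc n)) \<longlonglongrightarrow> 0 + 0"
    by (intro tendsto_add LIMSEQ_Suc[OF lim_1_over_n])
  then have "(\<lambda>n. dist w (s n)) \<longlonglongrightarrow> 0"
    using s(2) by (intro tendsto_sandwich[of "\<lambda>_. 0" "\<lambda>n. dist w (s n)" _ "\<lambda>n. infdist w (S n) + 1 / real (Suc n)"])
      (auto intro!: always_eventually less_imp_le)
  then have "s \<longlonglongrightarrow> w" unfolding tendsto_dist_iff[of s w] by (simp add: dist_commute)
  then show "\<exists>s. (\<forall>n. s n \<in> S n) \<and> s \<longlonglongrightarrow> w" using s(1) by blast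
next
  assume "\<exists>s. (\<forall>n. s n \<in> S n) \<and> s \<longlonglongrightarrow> w"
  then obtain s where "\<And>n. s n \<in> S n" "s \<longlonglongrightarrow> w" by blast
  then show "w \<in> lower_limit S"
    unfolding lower_limit_def by (auto dest!: tendstoD elim!: eventually_mono)
qed

lemma liminf_op_iff: "p \<in> liminf_op Ts \<longleftrightarrow> (\<exists>t. (\<forall>n. t n \<in> Ts n) \<and> t \<longlonglongrightarrow> p)"
proof
  assume "p \<in> liminf_op Ts"
  then obtain y ys where "\<forall>n. (y n, ys n) \<in> Ts n" "y \<longlonglongrightarrow> fst p" "ys \<longlonglongrightarrow> snd p"
    unfolding liminf_op_def by auto
  then show "\<exists>t. (\<forall>n. t n \<in> Ts n) \<and> t \<longlonglongrightarrow> p"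
    using tendsto_Pair[of y "fst p" sequentially ys "snd p"] by (intro exI[of _ "\<lambda>n. (y n, ys n)"]) auto
next
  assume "\<exists>t. (\<forall>n. t n \<in> Ts n) \<and> t \<longlonglongrightarrow> p"
  then obtain t where "\<forall>n. t n \<in> Ts n" "t \<longlonglongrightarrow> p" by blast
  then show "p \<in> liminf_op Ts"
    unfolding liminf_op_def case_prod_beta
    by (auto intro!: exI[of _ "\<lambda>n. fst (t n)"] exI[of _ "\<lambda>n. snd (t n)"] tendsto_fst tendsto_snd)
qed

theorem theorem3p3:
  fixes Ts :: "nat \<Rightarrow> ('a::banach \<times> ('a \<Rightarrow>\<^sub>L real)) set"
  assumes "\<And>n. maximal_monotone (Ts n)"
    and "\<And>n. type_D (Ts n)"
  shows "representable (liminf_op Ts)"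
proof -
  let ?A = "lower_limit (\<lambda>n. fitz_epi (Ts n))"
  have graph: "(t, duality_prod t) \<in> fitz_epi (Ts n)" if "t \<in> Ts n" for t n
    using assms(1)[of n] that monotone_op_graph_in_fitz_epi unfolding maximal_monotone_def by blast
  have "fitz_epi (Ts n) \<noteq> {}" for n
    using maximal_monotone_nonempty[OF assms(1)] graph by fastforce
  note A_iff = lower_limit_iff_sequence[OF this]
  have A_seq: "\<exists>q r. (\<forall>n. (q n, r n) \<in> fitz_epi (Ts n)) \<and> q \<longlonglongrightarrow> p \<and> r \<longlonglongrightarrow> s"
    if A: "(p, s) \<in> ?A" for p s
  proof -
    obtain w where "\<forall>n. w n \<in> fitz_epi (Ts n)" "w \<longlonglongrightarrow> (p, s)" using A unfolding A_iff by blast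
    then show ?thesis
      by (intro exI[of _ "\<lambda>n. fst (w n)"] exI[of _ "\<lambda>n. snd (w n)"]) (auto dest: tendsto_fst tendsto_snd)
  qed
  have ge: "duality_prod p \<le> s" if A: "(p, s) \<in> ?A" for p s
  proof -
    obtain q r where qr: "\<forall>n. (q n, r n) \<in> fitz_epi (Ts n)" "q \<longlonglongrightarrow> p" "r \<longlonglongrightarrow> s"
      using A_seq[OF A] by blast
    show ?thesis
      by (rule LIMSEQ_le[OF tendsto_duality_prod[OF qr(2)] qr(3)])
        (use qr(1) maximal_monotone_fitz_epi_ge[OF assms(1)] in blast)
  qed
  have up: "(p, s') \<in> ?A" if A: "(p, s) \<in> ?A" and le: "s \<le> s'" for p s s'
  proof -
    obtain q r where qr: "\<forall>n. (q n, r n) \<in> fitz_epi (Ts n)" "q \<longlonglongrightarrow> p" "r \<longlonglongrightarrow> s"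
      using A_seq[OF A] by blast
    have "(\<lambda>n. (q n, r n + (s' - s))) \<longlonglongrightarrow> (p, s + (s' - s))" by (intro tendsto_intros qr)
    then have "(\<lambda>n. (q n, r n + (s' - s))) \<longlonglongrightarrow> (p, s')" by simp
    moreover have "(q n, r n + (s' - s)) \<in> fitz_epi (Ts n)" for n
      using qr(1) le fitz_epi_mono[of "q n" "r n" "Ts n"] by simp
    ultimately show ?thesis unfolding A_iff by (intro exI[of _ "\<lambda>n. (q n, r n + (s' - s))"]) auto
  qed
  have eq: "liminf_op Ts = {p. (p, duality_prod p) \<in> ?A}"
  proof (intro set_eqI iffI; (elim CollectE)?)
    fix p assume "p \<in> liminf_op Ts"
    then obtain t where t: "\<And>n. t n \<in> Ts n" "t \<longlonglongrightarrow> p" unfolding liminf_op_iff by blast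
    then have "(\<lambda>n. (t n, duality_prod (t n))) \<longlonglongrightarrow> (p, duality_prod p)" by (intro tendsto_intros)
    then show "p \<in> {p. (p, duality_prod p) \<in> ?A}"
      using graph[OF t(1)] unfolding A_iff by (intro CollectI exI[of _ "\<lambda>n. (t n, duality_prod (t n))"]) auto
  next
    fix p assume "(p, duality_prod p) \<in> ?A"
    then obtain q r where qr: "\<And>n. (q n, r n) \<in> fitz_epi (Ts n)" "q \<longlonglongrightarrow> p" "r \<longlonglongrightarrow> duality_prod p"
      using A_seq by blast
    \<comment> \<open>The gap \<open>r n - duality_prod (q n)\<close> bounds the error at
      \<open>q n\<close> but may be 0; the added term makes \<open>\<delta> n\<close> positive and
      vanishes in the limit.\<close>
    define \<delta> where "\<delta> = (\<lambda>n. r n - duality_prod (q n) + 1 / real (Suc n))"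
    have \<delta>_pos: "\<delta> n > 0" for n
      using maximal_monotone_fitz_epi_ge[OF assms(1) qr(1), of n] unfolding \<delta>_def
      by (intro add_nonneg_pos) auto
    have "- \<delta> n \<le> duality_prod (t - q n)" if "t \<in> Ts n" for t n
    proof -
      have "duality_prod (q n) - r n \<le> duality_prod (t - q n)"
        using qr(1)[of n] that unfolding fitz_epi_def by blast
      moreover have "- \<delta> n \<le> duality_prod (q n) - r n" unfolding \<delta>_def by simp
      ultimately show ?thesis by linarith
    qed
    then have "\<exists>t\<in>Ts n. dist t (q n) \<le> 4 * sqrt (\<delta> n)" for n
      by (rule type_D_Bronsted_Rockafellar[OF assms(2) \<delta>_pos])
    then obtain t where t: "\<And>n. t n \<in> Ts n" "\<And>n. dist (t n) (q n) \<le> 4 * sqrt (\<delta> n)" by metis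
    \<comment> \<open>Both \<open>r n\<close> and \<open>duality_prod (q n)\<close> tend to
      \<open>duality_prod p\<close>, so the gap closes and \<open>t n\<close> has the same limit as
      \<open>q n\<close>.\<close>
    have "\<delta> \<longlonglongrightarrow> duality_prod p - duality_prod p + 0"
      unfolding \<delta>_def by (intro tendsto_intros qr LIMSEQ_Suc[OF lim_1_over_n])
    then have "(\<lambda>n. 4 * sqrt (\<delta> n)) \<longlonglongrightarrow> 4 * sqrt 0" by (intro tendsto_intros) simp
    then have "(\<lambda>n. dist (t n) (q n)) \<longlonglongrightarrow> 0"
      using t(2) by (intro tendsto_sandwich[of "\<lambda>_. 0" "\<lambda>n. dist (t n) (q n)" _ "\<lambda>n. 4 * sqrt (\<delta> n)"]) auto
    then have "(\<lambda>n. t n - q n) \<longlonglongrightarrow> 0" by (simp add: dist_norm tendsto_norm_zero_iff)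
    from tendsto_add[OF this qr(2)] have "t \<longlonglongrightarrow> p" by simp
    then show "p \<in> liminf_op Ts" using t(1) unfolding liminf_op_iff by blast
  qed
  show ?thesis
  proof (cases "?A = {}")
    case True
    then have "liminf_op Ts = {}" unfolding eq by simp
    then show ?thesis using representable_empty by metis
  next
    case False
    then show ?thesis unfolding eq
      by (intro representable_if_epigraph closed_lower_limit convex_lower_limit convex_fitz_epi) (use up ge in auto)
  qed
qed

end
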